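(* Let $-\infty<m<M<\infty$. Let $E$ be a non-empty set, let $L$ be a vector space of real-valued functions on $E$ satisfying (L1) and (L2), and let $A\colon L\to\mathbb{R}$ be any positive linear functional with $A(\boldsymbol{1})=1$. Let $\phi$ be a $3$-convex function defined on an interval $I\subseteq\mathbb{R}$ whose interior contains $[m,M]$, and suppose $\phi$ is differentiable on $(m,M)$. Then $$(A(f)-m)\left[\frac{\phi(M)-\phi(m)}{M-m}-\frac{\phi_+'(m)}{2}\right]-\frac{1}{2}A\big[(f-m\boldsymbol{1})\phi'(f)\big]$$ $$\le \frac{M-A(f)}{M-m}\phi(m)+\frac{A(f)-m}{M-m}\phi(M)-A(\phi(f))$$ $$\le \frac{1}{2}A\big[(M\boldsymbol{1}-f)\phi'(f)\big]-(M-A(f))\left[\frac{\phi(M)-\phi(m)}{M-m}-\frac{\phi_-'(M)}{2}\right]$$ holds for any $f\in L$ such that $\phi\circ f\in L$ and $m\le f(t)\le M$ for $t\in E$. If the function $-\phi$ is $3$-convex, then the inequalities are reversed.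
   Context: Conditions on $L$: (L1) $f,g\in L$ implies $af+bg\in L$ for all $a,b\in\mathbb{R}$; (L2) the constant function $\boldsymbol{1}$ (with $\boldsymbol{1}(t)=1$ for all $t\in E$) belongs to $L$. A positive linear functional $A\colon L\to\mathbb{R}$ satisfies $A(af+bg)=aA(f)+bA(g)$ for $f,g\in L$, $a,b\in\mathbb{R}$, and $A(f)\ge 0$ whenever $f\in L$ and $f(t)\ge 0$ for every $t\in E$. Divided differences: for mutually distinct points $t_0,\dots,t_n$, $[t_i]\phi=\phi(t_i)$ and $[t_0,\dots,t_n]\phi=\dfrac{[t_1,\dots,t_n]\phi-[t_0,\dots,t_{n-1}]\phi}{t_n-t_0}$. A function $\phi$ on an interval $I$ is $3$-convex if $[t_0,t_1,t_2,t_3]\phi\ge 0$ for all choices of four distinct points $t_0,t_1,t_2,t_3\in I$. $\phi(f)$ denotes $\phi\circ f$, and $\phi'(f)$ denotes $\phi'\circ f$; $\phi_+'$ and $\phi_-'$ denote the right and left derivatives of $\phi$. *)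

theory Defs
  imports "HOL-Analysis.Analysis"
begin

text \<open>Real-valued functions on the set \<open>E\<close> are represented by the elements of
  \<open>E \<rightarrow>\<^sub>E UNIV\<close>, so that functions agreeing on \<open>E\<close> are equal.\<close>

definition function_space :: "'e set \<Rightarrow> ('e \<Rightarrow> real) set \<Rightarrow> bool" where
  "function_space E L \<longleftrightarrow>
     L \<subseteq> (E \<rightarrow>\<^sub>E UNIV) \<and>
     (\<forall>f\<in>L. \<forall>g\<in>L. \<forall>a b. (\<lambda>t\<in>E. a * f t + b * g t) \<in> L) \<and>
     (\<lambda>t\<in>E. 1) \<in> L"

definition positive_linear_functional ::
    "'e set \<Rightarrow> ('e \<Rightarrow> real) set \<Rightarrow> (('e \<Rightarrow> real) \<Rightarrow> real) \<Rightarrow> bool" where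
  "positive_linear_functional E L A \<longleftrightarrow>
     (\<forall>f\<in>L. \<forall>g\<in>L. \<forall>a b. A (\<lambda>t\<in>E. a * f t + b * g t) = a * A f + b * A g) \<and>
     (\<forall>f\<in>L. (\<forall>t\<in>E. 0 \<le> f t) \<longrightarrow> 0 \<le> A f)"

text \<open>The value on the empty list is a dummy. For distinct points the denominator
  is nonzero.\<close>

fun divided_diff :: "(real \<Rightarrow> real) \<Rightarrow> real list \<Rightarrow> real" where
  "divided_diff \<phi> [] = 0"
| "divided_diff \<phi> [t] = \<phi> t"
| "divided_diff \<phi> (t # u # ts) =
     (divided_diff \<phi> (u # ts) - divided_diff \<phi> (butlast (t # u # ts)))
       / (last (u # ts) - t)"

definition three_convex_on :: "real set \<Rightarrow> (real \<Rightarrow> real) \<Rightarrow> bool" where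
  "three_convex_on I \<phi> \<longleftrightarrow>
     (\<forall>t0\<in>I. \<forall>t1\<in>I. \<forall>t2\<in>I. \<forall>t3\<in>I.
        distinct [t0, t1, t2, t3] \<longrightarrow> 0 \<le> divided_diff \<phi> [t0, t1, t2, t3])"

definition right_deriv :: "(real \<Rightarrow> real) \<Rightarrow> real \<Rightarrow> real" where
  "right_deriv \<phi> x = (THE D. (\<phi> has_real_derivative D) (at_right x))"

definition left_deriv :: "(real \<Rightarrow> real) \<Rightarrow> real \<Rightarrow> real" where
  "left_deriv \<phi> x = (THE D. (\<phi> has_real_derivative D) (at_left x))"

end

theory Submission
  imports Defs
begin

text \<open>
  The functional \<open>A\<close> is linear, positive and normalised, so it suffices to prove both inequalities
  with \<open>f\<close> replaced by a number \<open>x \<in> [m, M]\<close> and \<open>A\<close> by the identity. The chord through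
  \<open>(m, \<phi>(m))\<close> and \<open>(M, \<phi>(M))\<close> can be expanded from either endpoint; its slope then cancels on the
  two sides, and the claims become the trapezoid inequalities
  \<open>\<phi>(x) - \<phi>(m) \<le> (x - m) (\<phi>'(m) + \<phi>'(x)) / 2\<close> and
  \<open>\<phi>(M) - \<phi>(x) \<le> (M - x) (\<phi>'(x) + \<phi>'(M)) / 2\<close>.
  Each of them says that a confluent divided difference \<open>[a, a, b, b]\<phi>\<close> is nonnegative.

  Both this and the differentiability of \<open>\<phi>\<close> at the endpoints rest on one reformulation:
  for fixed \<open>c\<close>, 3-convexity makes the difference quotient \<open>s \<mapsto> (\<phi>(s) - \<phi>(c)) / (s - c)\<close> a function
  with increasing slopes off \<open>c\<close> (\<open>three_convex_quotient_slopes\<close>). Increasing slopes are bounded near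
  \<open>c\<close>, so the quotient is Lipschitz there and has a limit at \<open>c\<close>
  (\<open>three_convex_imp_differentiable\<close>). Letting two of three points tend to the ends of
  \<open>[a, b]\<close> in the slope inequality for \<open>c = a\<close> gives the trapezoid inequality
  (\<open>three_convex_trapezoid\<close>).

  The existence of two-sided derivatives at \<open>m\<close> and \<open>M\<close> matters for the statement itself: \<open>f\<close> may take
  these values, and there \<open>deriv \<phi>\<close> has to agree with the one-sided derivatives. If \<open>-\<phi>\<close> is
  3-convex, differentiability and the reversed trapezoid inequalities follow by applying these facts to \<open>-\<phi>\<close>.
\<close>

section \<open>Difference quotients of 3-convex functions\<close>

definition diff_quot :: "(real \<Rightarrow> real) \<Rightarrow> real \<Rightarrow> real \<Rightarrow> real" where
  "diff_quot \<phi> c s = (\<phi> s - \<phi> c) / (s - c)"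

lemma diff_quot_commute: "diff_quot \<phi> c s = diff_quot \<phi> s c"
  unfolding diff_quot_def
  using minus_divide_divide[of "\<phi> s - \<phi> c" "s - c"] by simp

text \<open>The divided differences of order one of \<open>diff_quot \<phi> c\<close> are the divided differences of order two
  of \<open>\<phi>\<close> with \<open>c\<close> as one of the points, so nonnegativity of \<open>[s, c, t, u]\<phi>\<close> compares two consecutive
  slopes of the quotient. As divided differences are symmetric in their points, \<open>c\<close> may lie anywhere
  relative to \<open>s < t < u\<close>; placing it second in the list makes one of the two slopes appear directly
  in the recursion.\<close>

lemma three_convex_quotient_slopes:
  assumes "three_convex_on I \<phi>" "c \<in> I" "s \<in> I" "t \<in> I" "u \<in> I"
    and "s < t" "t < u" "s \<noteq> c" "t \<noteq> c" "u \<noteq> c"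
  shows "diff_quot (diff_quot \<phi> c) s t \<le> diff_quot (diff_quot \<phi> c) t u"
proof -
  have "distinct [s, c, t, u]" using assms by auto
  then have "0 \<le> divided_diff \<phi> [s, c, t, u]"
    using assms unfolding three_convex_on_def by blast
  also have "divided_diff \<phi> [s, c, t, u] =
      ((diff_quot \<phi> t u - diff_quot \<phi> c t) / (u - c)
        - (diff_quot \<phi> c t - diff_quot \<phi> s c) / (t - s)) / (u - s)"
    by (simp add: diff_quot_def)
  finally have "(diff_quot \<phi> c t - diff_quot \<phi> s c) / (t - s)
      \<le> (diff_quot \<phi> t u - diff_quot \<phi> c t) / (u - c)"
    using assms by (simp add: zero_le_divide_iff)
  moreover have "(diff_quot \<phi> t u - diff_quot \<phi> c t) / (u - c)
      = (diff_quot \<phi> c u - diff_quot \<phi> c t) / (u - t)"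
  proof -
    have "\<phi> u - \<phi> t = diff_quot \<phi> c u * (u - c) - diff_quot \<phi> c t * (t - c)"
      using assms by (simp add: diff_quot_def)
    then have "diff_quot \<phi> t u
        = (diff_quot \<phi> c u * (u - c) - diff_quot \<phi> c t * (t - c)) / (u - t)"
      by (simp add: diff_quot_def)
    then show ?thesis
      using assms by (simp add: field_simps)
  qed
  ultimately show ?thesis
    by (simp add: diff_quot_def[of "diff_quot \<phi> c"] diff_quot_commute[of \<phi> s c])
qed

text \<open>Slopes of the quotient between points near \<open>c\<close> lie between its slopes on two fixed intervals,
  one on each side farther away from \<open>c\<close>. Hence the quotient is Lipschitz on a punctured neighbourhood
  of \<open>c\<close>, and a uniformly continuous function has limits at the closure of its domain.\<close>

lemma three_convex_imp_differentiable:
  assumes conv: "three_convex_on I \<phi>" and c: "c \<in> interior I"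
  shows "(\<phi> has_real_derivative deriv \<phi> c) (at c)"
proof -
  let ?q = "diff_quot \<phi> c"
  obtain e where e: "e > 0" "cball c e \<subseteq> I"
    using c mem_interior_cball by blast
  have inI: "x \<in> I" if "\<bar>x - c\<bar> \<le> e" for x
    using e that by (auto simp: cball_def dist_real_def abs_minus_commute)
  define S where "S = {c - e/2<..<c + e/2} - {c}"
  define K1 where "K1 = diff_quot ?q (c - e) (c - e/2)"
  define K2 where "K2 = diff_quot ?q (c + e/2) (c + e)"
  have slope: "diff_quot ?q s t \<le> diff_quot ?q t u"
    if "s < t" "t < u" "s \<noteq> c" "t \<noteq> c" "u \<noteq> c" "c - e \<le> s" "u \<le> c + e" for s t u
    using that e by (intro three_convex_quotient_slopes[OF conv]) (auto intro!: inI)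
  have slope_bounds: "K1 \<le> diff_quot ?q s t \<and> diff_quot ?q s t \<le> K2"
    if "s \<in> S" "t \<in> S" "s < t" for s t
  proof -
    have st: "c - e/2 < s" "t < c + e/2" "s \<noteq> c" "t \<noteq> c"
      using that by (auto simp: S_def)
    have "K1 \<le> diff_quot ?q (c - e/2) s"
      unfolding K1_def by (rule slope) (use st that e in auto)
    also have "\<dots> \<le> diff_quot ?q s t"
      by (rule slope) (use st that e in auto)
    finally have "K1 \<le> diff_quot ?q s t" .
    moreover have "diff_quot ?q s t \<le> diff_quot ?q t (c + e/2)"
      by (rule slope) (use st that e in auto)
    moreover have "diff_quot ?q t (c + e/2) \<le> K2"
      unfolding K2_def by (rule slope) (use st that e in auto)
    ultimately show ?thesis by linarith
  qed
  have lip: "\<bar>?q t - ?q s\<bar> \<le> (\<bar>K1\<bar> + \<bar>K2\<bar>) * (t - s)"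
    if "s \<in> S" "t \<in> S" "s < t" for s t
  proof -
    have "\<bar>diff_quot ?q s t\<bar> \<le> \<bar>K1\<bar> + \<bar>K2\<bar>"
      using slope_bounds[OF that] by linarith
    then show ?thesis
      using that by (simp add: diff_quot_def[of ?q] abs_divide pos_divide_le_eq)
  qed
  have "(\<bar>K1\<bar> + \<bar>K2\<bar>)-lipschitz_on S ?q"
  proof (rule lipschitz_onI)
    fix s t assume "s \<in> S" "t \<in> S"
    then show "dist (?q s) (?q t) \<le> (\<bar>K1\<bar> + \<bar>K2\<bar>) * dist s t"
      using lip[of s t] lip[of t s]
      by (cases s t rule: linorder_cases) (auto simp: dist_real_def abs_minus_commute)
  qed simp
  then have "uniformly_continuous_on S ?q"
    by (rule lipschitz_on_uniformly_continuous)
  moreover have "c \<in> closure S"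
  proof -
    have "c islimpt {c - e/2<..<c + e/2}"
      using e by (intro interior_limit_point) (simp add: interior_open)
    then show ?thesis
      by (simp add: S_def islimpt_in_closure)
  qed
  ultimately obtain D where "(?q \<longlongrightarrow> D) (at c within S)"
    using uniformly_continuous_on_extension_at_closure by blast
  moreover have "at c within S = at c"
  proof -
    have "at c within S = at c within {c - e/2<..<c + e/2}"
      unfolding S_def by (simp add: at_within_def)
    also have "\<dots> = at c"
      using e by (intro at_within_open) auto
    finally show ?thesis .
  qed
  ultimately have "(\<phi> has_real_derivative D) (at c)"
    unfolding has_field_derivative_iff diff_quot_def[abs_def] by simp
  then show ?thesis
    by (metis DERIV_imp_deriv)
qed

section \<open>The trapezoid inequality\<close>

text \<open>Up to a positive factor this is \<open>[a, a, b, b]\<phi> \<ge> 0\<close>. The slope inequality for the quotient at \<open>a\<close> and points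
  \<open>a < s < t < b\<close> is passed to the limit \<open>s \<rightarrow> a\<close>, where the quotient tends to \<open>\<phi>'(a)\<close>, and then
  \<open>t \<rightarrow> b\<close>, where its last slope tends to its derivative at \<open>b\<close>.\<close>

lemma three_convex_trapezoid:
  assumes conv: "three_convex_on I \<phi>" and sub: "{a..b} \<subseteq> I" and "a \<le> b"
    and da: "(\<phi> has_real_derivative da) (at a)"
    and db: "(\<phi> has_real_derivative db) (at b)"
  shows "\<phi> b - \<phi> a \<le> (b - a) * (da + db) / 2"
proof (cases "a = b")
  case False
  then have "a < b" using \<open>a \<le> b\<close> by simp
  let ?q = "diff_quot \<phi> a"
  have q_a: "(?q \<longlongrightarrow> da) (at_right a)"
    using da unfolding has_field_derivative_iff diff_quot_def[abs_def]
    by (rule filterlim_mono) (auto simp: at_le)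
  define dq where "dq = (db - ?q b) / (b - a)"
  have q_b: "(?q has_real_derivative dq) (at b)"
    unfolding diff_quot_def[abs_def] dq_def
    using \<open>a < b\<close> by (auto intro!: derivative_eq_intros db simp: field_simps)
  have slope_t: "(?q t - da) / (t - a) \<le> diff_quot ?q t b" if "a < t" "t < b" for t
  proof (rule tendsto_upperbound)
    show "((\<lambda>s. diff_quot ?q s t) \<longlongrightarrow> (?q t - da) / (t - a)) (at_right a)"
      unfolding diff_quot_def[of ?q] using that by (intro tendsto_intros q_a) auto
    have "eventually (\<lambda>s. s \<in> {a<..<t}) (at_right a)"
      using \<open>a < t\<close> by (rule eventually_at_right_real)
    then show "eventually (\<lambda>s. diff_quot ?q s t \<le> diff_quot ?q t b) (at_right a)"
    proof eventually_elim
      case (elim s)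
      then show ?case
        using that sub by (intro three_convex_quotient_slopes[OF conv]) auto
    qed
  qed simp
  have "(?q b - da) / (b - a) \<le> dq"
  proof (rule tendsto_le)
    have "(?q \<longlongrightarrow> ?q b) (at_left b)"
      using DERIV_isCont[OF q_b] by (auto simp: isCont_def intro: filterlim_mono at_le)
    then show "((\<lambda>t. (?q t - da) / (t - a)) \<longlongrightarrow> (?q b - da) / (b - a)) (at_left b)"
      using \<open>a < b\<close> by (intro tendsto_intros) auto
    have "((\<lambda>t. diff_quot ?q b t) \<longlongrightarrow> dq) (at_left b)"
      using q_b unfolding has_field_derivative_iff diff_quot_def[of ?q]
      by (rule filterlim_mono) (auto simp: at_le)
    then show "((\<lambda>t. diff_quot ?q t b) \<longlongrightarrow> dq) (at_left b)"
      by (simp only: diff_quot_commute[of ?q b])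
    have "eventually (\<lambda>t. t \<in> {a<..<b}) (at_left b)"
      using \<open>a < b\<close> by (rule eventually_at_left_real)
    then show "eventually (\<lambda>t. (?q t - da) / (t - a) \<le> diff_quot ?q t b) (at_left b)"
      by eventually_elim (use slope_t in auto)
  qed simp
  then have "?q b - da \<le> db - ?q b"
    unfolding dq_def using \<open>a < b\<close> by (simp add: divide_le_cancel)
  then have "(b - a) * (2 * ?q b) \<le> (b - a) * (da + db)"
    using \<open>a < b\<close> by (intro mult_left_mono) auto
  then show ?thesis
    using \<open>a < b\<close> by (simp add: diff_quot_def)
qed simp

section \<open>Normalised positive functionals\<close>

text \<open>The pointwise trapezoid inequalities are affine in three functions of \<open>L\<close>, namely \<open>f\<close>, \<open>\<phi>(f)\<close> and a
  product with \<open>\<phi>'(f)\<close>. In this form a normalised positive functional carries them over to its values.\<close>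

lemma positive_functional_affine_nonneg:
  assumes L: "function_space E L" and A: "positive_linear_functional E L A"
    and one: "A (\<lambda>t\<in>E. 1) = 1"
    and mem: "f \<in> L" "g \<in> L" "h \<in> L"
    and nonneg: "\<And>t. t \<in> E \<Longrightarrow> 0 \<le> a + b * f t + c * g t + d * h t"
  shows "0 \<le> a + b * A f + c * A g + d * A h"
proof -
  have lin: "(\<lambda>t\<in>E. x * u t + y * v t) \<in> L"
      "A (\<lambda>t\<in>E. x * u t + y * v t) = x * A u + y * A v"
    if "u \<in> L" "v \<in> L" for u v x y
    using L A that unfolding function_space_def positive_linear_functional_def by blast+
  define p where "p = (\<lambda>t\<in>E. a * (\<lambda>t\<in>E. 1) t + b * f t)"
  define r where "r = (\<lambda>t\<in>E. c * g t + d * h t)"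
  define k where "k = (\<lambda>t\<in>E. 1 * p t + 1 * r t)"
  have "(\<lambda>t\<in>E. 1) \<in> L"
    using L by (simp add: function_space_def)
  then have p: "p \<in> L" "A p = a + b * A f"
    using lin[of "\<lambda>t\<in>E. 1" f a b] mem one by (simp_all add: p_def)
  have r: "r \<in> L" "A r = c * A g + d * A h"
    using lin[of g h c d] mem by (simp_all add: r_def)
  have k: "k \<in> L" "A k = A p + A r"
    using lin[OF p(1) r(1), of 1 1] by (simp_all add: k_def)
  have "\<forall>t\<in>E. 0 \<le> k t"
    using nonneg by (simp add: k_def p_def r_def add.assoc)
  then have "0 \<le> A k"
    using A k(1) unfolding positive_linear_functional_def by blast
  then show ?thesis
    using k p r by simp
qed

section \<open>One-sided derivatives\<close>

lemma right_deriv_eq_deriv: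
  assumes "(\<phi> has_real_derivative D) (at x)"
  shows "right_deriv \<phi> x = D"
  unfolding right_deriv_def
proof (rule the_equality)
  show R: "(\<phi> has_real_derivative D) (at_right x)"
    using assms by (rule has_field_derivative_at_within)
  show "D' = D" if "(\<phi> has_real_derivative D') (at_right x)" for D'
    using that R unfolding has_field_derivative_iff
    by (intro tendsto_unique[OF trivial_limit_at_right_real])
qed

lemma left_deriv_eq_deriv:
  assumes "(\<phi> has_real_derivative D) (at x)"
  shows "left_deriv \<phi> x = D"
  unfolding left_deriv_def
proof (rule the_equality)
  show R: "(\<phi> has_real_derivative D) (at_left x)"
    using assms by (rule has_field_derivative_at_within)
  show "D' = D" if "(\<phi> has_real_derivative D') (at_left x)" for D'
    using that R unfolding has_field_derivative_iff
    by (intro tendsto_unique[OF trivial_limit_at_left_real])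
qed

section \<open>Bounds for the defect of the chord inequality\<close>

theorem theorem2p2:
  fixes m M :: real
    and E :: "'e set"
    and L :: "('e \<Rightarrow> real) set"
    and A :: "('e \<Rightarrow> real) \<Rightarrow> real"
    and \<phi> :: "real \<Rightarrow> real"
    and I :: "real set"
    and f :: "'e \<Rightarrow> real"
  assumes "m < M"
    and "E \<noteq> {}"
    and "function_space E L"
    and "positive_linear_functional E L A"
    and "A (\<lambda>t\<in>E. 1) = 1"
    and "is_interval I"
    and "{m..M} \<subseteq> interior I"
    and "\<phi> differentiable_on {m<..<M}"
    and "f \<in> L"
    and "(\<lambda>t\<in>E. \<phi> (f t)) \<in> L"
    and "\<forall>t\<in>E. m \<le> f t \<and> f t \<le> M"
  shows
    "let G = (\<lambda>t\<in>E. (f t - m) * deriv \<phi> (f t));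
         H = (\<lambda>t\<in>E. (M - f t) * deriv \<phi> (f t));
         lower = (A f - m) * ((\<phi> M - \<phi> m) / (M - m) - right_deriv \<phi> m / 2) - 1/2 * A G;
         middle = (M - A f) / (M - m) * \<phi> m + (A f - m) / (M - m) * \<phi> M
                    - A (\<lambda>t\<in>E. \<phi> (f t));
         upper = 1/2 * A H - (M - A f) * ((\<phi> M - \<phi> m) / (M - m) - left_deriv \<phi> M / 2)
     in (three_convex_on I \<phi> \<longrightarrow>
           (G \<in> L \<longrightarrow> lower \<le> middle) \<and> (H \<in> L \<longrightarrow> middle \<le> upper)) \<and>
        (three_convex_on I (\<lambda>x. - \<phi> x) \<longrightarrow>
           (G \<in> L \<longrightarrow> middle \<le> lower) \<and> (H \<in> L \<longrightarrow> upper \<le> middle))"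
proof -
  define G where "G = (\<lambda>t\<in>E. (f t - m) * deriv \<phi> (f t))"
  define H where "H = (\<lambda>t\<in>E. (M - f t) * deriv \<phi> (f t))"
  define F where "F = (\<lambda>t\<in>E. \<phi> (f t))"
  define slope where "slope = (\<phi> M - \<phi> m) / (M - m)"
  define lower where "lower = (A f - m) * (slope - right_deriv \<phi> m / 2) - 1/2 * A G"
  define middle where "middle = (M - A f) / (M - m) * \<phi> m + (A f - m) / (M - m) * \<phi> M - A F"
  define upper where "upper = 1/2 * A H - (M - A f) * (slope - left_deriv \<phi> M / 2)"
  note affine_nonneg =
    positive_functional_affine_nonneg[OF assms(3-5) \<open>f \<in> L\<close> assms(10)[folded F_def]]
  have slope: "slope * (M - m) = \<phi> M - \<phi> m"
    using \<open>m < M\<close> by (simp add: slope_def)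
  have sub: "{m..M} \<subseteq> I"
    using assms(7) interior_subset by blast
  have range: "m \<le> f t" "f t \<le> M" if "t \<in> E" for t
    using assms(11) that by auto

  \<comment> \<open>With the chord expanded from the endpoint at which \<open>lower\<close>, respectively \<open>upper\<close>, is based,
    \<open>slope\<close> cancels from the comparison.\<close>
  have "middle = (\<phi> m * (M - m) + (\<phi> M - \<phi> m) * (A f - m)) / (M - m) - A F"
    unfolding middle_def times_divide_eq_left add_divide_distrib[symmetric]
    by (simp add: algebra_simps)
  also have "\<dots> = \<phi> m + slope * (A f - m) - A F"
    using \<open>m < M\<close> by (simp add: slope_def add_divide_distrib)
  finally have middle_left: "middle = \<phi> m + slope * (A f - m) - A F" .
  have "\<phi> M = \<phi> m + slope * (M - m)"
    using slope by simp
  then have middle_right: "middle = \<phi> M - slope * (M - A f) - A F"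
    using middle_left by (simp add: algebra_simps)

  define dm where "dm = deriv \<phi> m / 2"
  define dM where "dM = deriv \<phi> M / 2"
  have convex: "(G \<in> L \<longrightarrow> lower \<le> middle) \<and> (H \<in> L \<longrightarrow> middle \<le> upper)"
    if conv: "three_convex_on I \<phi>"
  proof -
    have der: "(\<phi> has_real_derivative deriv \<phi> x) (at x)" if "m \<le> x" "x \<le> M" for x
      using three_convex_imp_differentiable[OF conv] assms(7) that by auto
    have rd: "right_deriv \<phi> m = deriv \<phi> m" and ld: "left_deriv \<phi> M = deriv \<phi> M"
      using der \<open>m < M\<close> by (auto intro!: right_deriv_eq_deriv left_deriv_eq_deriv)
    have trap: "\<phi> y - \<phi> x \<le> (y - x) * (deriv \<phi> x + deriv \<phi> y) / 2"
      if "m \<le> x" "x \<le> y" "y \<le> M" for x y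
      by (rule three_convex_trapezoid[OF conv]) (use that sub der in auto)
    have "lower \<le> middle" if "G \<in> L"
    proof -
      have "0 \<le> (\<phi> m - m * dm) + dm * A f + (-1) * A F + 1/2 * A G"
      proof (rule affine_nonneg[OF that])
        fix t assume "t \<in> E"
        then show "0 \<le> (\<phi> m - m * dm) + dm * f t + (-1) * F t + 1/2 * G t"
          using trap[of m "f t"] range by (simp add: F_def G_def dm_def field_simps)
      qed
      then show ?thesis
        unfolding lower_def middle_left rd dm_def[symmetric] by (simp add: algebra_simps)
    qed
    moreover have "middle \<le> upper" if "H \<in> L"
    proof -
      have "0 \<le> (M * dM - \<phi> M) + (- dM) * A f + 1 * A F + 1/2 * A H"
      proof (rule affine_nonneg[OF that])
        fix t assume "t \<in> E"
        then show "0 \<le> (M * dM - \<phi> M) + (- dM) * f t + 1 * F t + 1/2 * H t"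
          using trap[of "f t" M] range by (simp add: F_def H_def dM_def field_simps)
      qed
      then show ?thesis
        unfolding upper_def middle_right ld dM_def[symmetric] by (simp add: algebra_simps)
    qed
    ultimately show ?thesis by blast
  qed

  have concave: "(G \<in> L \<longrightarrow> middle \<le> lower) \<and> (H \<in> L \<longrightarrow> upper \<le> middle)"
    if conv: "three_convex_on I (\<lambda>x. - \<phi> x)"
  proof -
    have der: "(\<phi> has_real_derivative deriv \<phi> x) (at x)" if "m \<le> x" "x \<le> M" for x
    proof -
      have "((\<lambda>x. - \<phi> x) has_real_derivative deriv (\<lambda>x. - \<phi> x) x) (at x)"
        using three_convex_imp_differentiable[OF conv] assms(7) that by auto
      from DERIV_minus[OF this] show ?thesis
        using DERIV_imp_deriv by fastforce
    qed
    have rd: "right_deriv \<phi> m = deriv \<phi> m" and ld: "left_deriv \<phi> M = deriv \<phi> M"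
      using der \<open>m < M\<close> by (auto intro!: right_deriv_eq_deriv left_deriv_eq_deriv)
    have trap: "(y - x) * (deriv \<phi> x + deriv \<phi> y) / 2 \<le> \<phi> y - \<phi> x"
      if "m \<le> x" "x \<le> y" "y \<le> M" for x y
    proof -
      have "- \<phi> y - (- \<phi> x) \<le> (y - x) * (- deriv \<phi> x + - deriv \<phi> y) / 2"
        by (rule three_convex_trapezoid[OF conv]) (use that sub in \<open>auto intro!: DERIV_minus der\<close>)
      then show ?thesis by (simp add: field_simps)
    qed
    have "middle \<le> lower" if "G \<in> L"
    proof -
      have "0 \<le> (m * dm - \<phi> m) + (- dm) * A f + 1 * A F + (-1/2) * A G"
      proof (rule affine_nonneg[OF that])
        fix t assume "t \<in> E"
        then show "0 \<le> (m * dm - \<phi> m) + (- dm) * f t + 1 * F t + (-1/2) * G t"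
          using trap[of m "f t"] range by (simp add: F_def G_def dm_def field_simps)
      qed
      then show ?thesis
        unfolding lower_def middle_left rd dm_def[symmetric] by (simp add: algebra_simps)
    qed
    moreover have "upper \<le> middle" if "H \<in> L"
    proof -
      have "0 \<le> (\<phi> M - M * dM) + dM * A f + (-1) * A F + (-1/2) * A H"
      proof (rule affine_nonneg[OF that])
        fix t assume "t \<in> E"
        then show "0 \<le> (\<phi> M - M * dM) + dM * f t + (-1) * F t + (-1/2) * H t"
          using trap[of "f t" M] range by (simp add: F_def H_def dM_def field_simps)
      qed
      then show ?thesis
        unfolding upper_def middle_right ld dM_def[symmetric] by (simp add: algebra_simps)
    qed
    ultimately show ?thesis by blast
  qed

  show ?thesis
    using convex concave
    unfolding Let_def lower_def middle_def upper_def slope_def G_def H_def F_def by blast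
qed

end
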